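(* Let $\kappa>0$ and let $X$ be a complete CAT($\kappa$) space with $\operatorname{diam}(X)\le\frac{\pi-\varepsilon}{2\sqrt{\kappa}}$ for some $\varepsilon\in(0,\pi/2)$, and put $R=(\pi-2\varepsilon)\tan(\varepsilon)$. Let $K$ be a nonempty compact convex subset of $X$, and let $T:K\to KC(X)$ be a generalized multivalued hybrid mapping of type II with $\frac{2k_1(x)}{1-a_2(x)}<\frac{R}{2}$ for all $x\in K$, $F(T)\neq\emptyset$ and $Tp=\{p\}$ for all $p\in F(T)$. Let $\{\alpha_n\},\{\beta_n\}$ be sequences in $[0,1]$ and let $\{x_n\}$ be a sequence in $K$ defined by $$x_{n+1}=P_K((1-\alpha_n)y_n\oplus\alpha_n u_n),\qquad y_n=P_K((1-\beta_n)x_n\oplus\beta_n v_n),$$ where $u_n\in Ty_n$ and $v_n\in Tx_n$. Suppose that, for all $x\in K$, $$\liminf_{n\to\infty}\alpha_n\Big[(1-\alpha_n)\frac{R}{2}-\frac{2k_2(x)}{1-a_3(x)}\Big]>0\quad\text{and}\quad \liminf_{n\to\infty}\beta_n\Big[(1-\beta_n)\frac{R}{2}-\frac{2k_2(x)}{1-a_3(x)}\Big]>0.$$ Then $\{x_n\}$ has a $\Delta$-limit, and this limit is in $F(T)$.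
   Context: $(X,d)$ is a metric space. A CAT($\kappa$) space ($\kappa>0$) is a metric space in which any two points at distance less than $D_\kappa=\pi/\sqrt{\kappa}$ are joined by a geodesic, and in which every geodesic triangle of perimeter less than $2D_\kappa$ satisfies $d(p,q)\le d(\bar p,\bar q)$ for all points $p,q$ of the triangle and their comparison points $\bar p,\bar q$ in a comparison triangle in the model surface $M_\kappa^2$ (the sphere $S^2$ with its distance multiplied by $1/\sqrt{\kappa}$). A subset is convex if it contains every geodesic segment joining any two of its points. For $x,y\in X$ and $t\in[0,1]$, $(1-t)x\oplus ty$ is the point $z$ of the geodesic segment $[x,y]$ with $d(z,x)=t\,d(x,y)$ and $d(z,y)=(1-t)d(x,y)$. $P_K:X\to K$ is the metric projection ($P_K(x)$ is the unique point of $K$ nearest to $x$). $KC(X)$ is the family of nonempty compact convex subsets of $X$. $F(T)=\{x\in K: x\in Tx\}$. For a set $B$, $d(x,B)=d(B,x)=\inf\{d(x,y):y\in B\}$, and $H(A,B)=\max\{\sup_{x\in A}d(x,B),\sup_{x\in B}d(x,A)\}$ is the Hausdorff metric. For a bounded sequence $\{x_n\}$ put $r(x,\{x_n\})=\limsup_{n\to\infty}d(x,x_n)$, $r(\{x_n\})=\inf_{x\in X}r(x,\{x_n\})$; the asymptotic center is $A(\{x_n\})=\{x\in X: r(x,\{x_n\})=r(\{x_n\})\}$. The sequence $\{x_n\}$ is $\Delta$-convergent to $x$ ($x$ is the $\Delta$-limit) if $x$ is the unique asymptotic center of every subsequence of $\{x_n\}$. $T$ is a generalized multivalued hybrid mapping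 of type II on $K$ (with coefficient functions $a_1,a_2,a_3,k_1,k_2:K\to[0,1]$) if $a_1(x)+a_2(x)+a_3(x)<1$, $2k_1(x)<1-a_2(x)$ and $2k_2(x)<1-a_3(x)$ for all $x\in K$, and $$H^2(Tx,Ty)\le a_1(x)d^2(x,y)+a_2(x)d^2(Tx,y)+a_3(x)d^2(x,Ty)+k_1(x)d^2(Tx,x)+k_2(x)d^2(Ty,y)$$ for all $x,y\in K$. *)

theory Defs
  imports "HOL-Analysis.Analysis"
begin

text \<open>
  Geodesics are defined relative to a carrier and a distance function, because they are used both
  for the space itself and for the model surface, whose distance depends on the parameter
  \<open>\<kappa>\<close> and is not the distance induced from the ambient Euclidean space.
\<close>

definition geodesic_segment :: "'a set \<Rightarrow> ('a \<Rightarrow> 'a \<Rightarrow> real) \<Rightarrow> 'a \<Rightarrow> 'a \<Rightarrow> 'a set \<Rightarrow> bool" where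
  "geodesic_segment M d x y S \<longleftrightarrow>
     (\<exists>c. c \<in> {0..d x y} \<rightarrow> M \<and> c 0 = x \<and> c (d x y) = y \<and>
          (\<forall>s\<in>{0..d x y}. \<forall>t\<in>{0..d x y}. d (c s) (c t) = \<bar>s - t\<bar>) \<and>
          S = c ` {0..d x y})"

definition geodesic_triangle ::
    "'a set \<Rightarrow> ('a \<Rightarrow> 'a \<Rightarrow> real) \<Rightarrow> 'a \<Rightarrow> 'a \<Rightarrow> 'a \<Rightarrow> 'a set \<Rightarrow> 'a set \<Rightarrow> 'a set \<Rightarrow> bool" where
  "geodesic_triangle M d p q r A B C \<longleftrightarrow>
     geodesic_segment M d p q A \<and> geodesic_segment M d q r B \<and> geodesic_segment M d r p C"

definition model_carrier :: "(real^3) set" where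
  "model_carrier = sphere 0 1"

definition model_dist :: "real \<Rightarrow> real^3 \<Rightarrow> real^3 \<Rightarrow> real" where
  "model_dist \<kappa> u v = arccos (u \<bullet> v) / sqrt \<kappa>"

definition comparison_triangle ::
    "real \<Rightarrow> ('a \<Rightarrow> 'a \<Rightarrow> real) \<Rightarrow> 'a \<Rightarrow> 'a \<Rightarrow> 'a \<Rightarrow>
     real^3 \<Rightarrow> real^3 \<Rightarrow> real^3 \<Rightarrow> (real^3) set \<Rightarrow> (real^3) set \<Rightarrow> (real^3) set \<Rightarrow> bool" where
  "comparison_triangle \<kappa> d p q r p' q' r' A' B' C' \<longleftrightarrow>
     geodesic_triangle model_carrier (model_dist \<kappa>) p' q' r' A' B' C' \<and>
     model_dist \<kappa> p' q' = d p q \<and> model_dist \<kappa> q' r' = d q r \<and> model_dist \<kappa> r' p' = d r p"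

text \<open>\<open>x'\<close> is the comparison point, on the side \<open>S'\<close> issuing from \<open>p'\<close>, of the
  point \<open>x\<close> on the side \<open>S\<close> issuing from \<open>p\<close>.\<close>

definition side_comparison_point ::
    "real \<Rightarrow> ('a \<Rightarrow> 'a \<Rightarrow> real) \<Rightarrow> 'a \<Rightarrow> 'a set \<Rightarrow> real^3 \<Rightarrow> (real^3) set \<Rightarrow> 'a \<Rightarrow> real^3 \<Rightarrow> bool" where
  "side_comparison_point \<kappa> d p S p' S' x x' \<longleftrightarrow>
     x \<in> S \<and> x' \<in> S' \<and> model_dist \<kappa> p' x' = d p x"

definition comparison_point ::
    "real \<Rightarrow> ('a \<Rightarrow> 'a \<Rightarrow> real) \<Rightarrow> 'a \<Rightarrow> 'a \<Rightarrow> 'a \<Rightarrow> 'a set \<Rightarrow> 'a set \<Rightarrow> 'a set \<Rightarrow>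
     real^3 \<Rightarrow> real^3 \<Rightarrow> real^3 \<Rightarrow> (real^3) set \<Rightarrow> (real^3) set \<Rightarrow> (real^3) set \<Rightarrow>
     'a \<Rightarrow> real^3 \<Rightarrow> bool" where
  "comparison_point \<kappa> d p q r A B C p' q' r' A' B' C' x x' \<longleftrightarrow>
     side_comparison_point \<kappa> d p A p' A' x x' \<or>
     side_comparison_point \<kappa> d q B q' B' x x' \<or>
     side_comparison_point \<kappa> d r C r' C' x x'"

text \<open>
  A comparison triangle of a triangle of perimeter less than \<open>2 * pi / sqrt \<kappa>\<close> exists and is
  unique up to an isometry of the model surface, so it does not matter which one is used.
\<close>

definition CAT_space :: "real \<Rightarrow> 'a set \<Rightarrow> ('a \<Rightarrow> 'a \<Rightarrow> real) \<Rightarrow> bool" where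
  "CAT_space \<kappa> M d \<longleftrightarrow>
     (\<forall>x\<in>M. \<forall>y\<in>M. d x y < pi / sqrt \<kappa> \<longrightarrow> (\<exists>S. geodesic_segment M d x y S)) \<and>
     (\<forall>p\<in>M. \<forall>q\<in>M. \<forall>r\<in>M. \<forall>A B C.
        geodesic_triangle M d p q r A B C \<and> d p q + d q r + d r p < 2 * (pi / sqrt \<kappa>) \<longrightarrow>
        (\<exists>p' q' r' A' B' C'.
           comparison_triangle \<kappa> d p q r p' q' r' A' B' C' \<and>
           (\<forall>x y x' y'.
              comparison_point \<kappa> d p q r A B C p' q' r' A' B' C' x x' \<and>
              comparison_point \<kappa> d p q r A B C p' q' r' A' B' C' y y' \<longrightarrow>
              d x y \<le> model_dist \<kappa> x' y')))"

definition geodesically_convex :: "'a::metric_space set \<Rightarrow> bool" where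
  "geodesically_convex K \<longleftrightarrow>
     (\<forall>x\<in>K. \<forall>y\<in>K. \<forall>S. geodesic_segment UNIV dist x y S \<longrightarrow> S \<subseteq> K)"

definition KC :: "'a::metric_space set set" where
  "KC = {S. S \<noteq> {} \<and> compact S \<and> geodesically_convex S}"

text \<open>
  \<open>geodesic_point t x y\<close> is \<open>(1 - t) x \<oplus> t y\<close>. In a CAT(\<open>\<kappa>\<close>) space the point exists and is
  unique when \<open>t \<in> {0..1}\<close> and \<open>dist x y < pi / sqrt \<kappa>\<close>.
\<close>

definition geodesic_point :: "real \<Rightarrow> 'a \<Rightarrow> 'a \<Rightarrow> 'a::metric_space" where
  "geodesic_point t x y =
     (THE z. (\<exists>S. geodesic_segment UNIV dist x y S \<and> z \<in> S) \<and>
             dist z x = t * dist x y \<and> dist z y = (1 - t) * dist x y)"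

definition metric_proj :: "'a set \<Rightarrow> 'a \<Rightarrow> 'a::metric_space" where
  "metric_proj K x = (THE z. z \<in> K \<and> (\<forall>w\<in>K. dist x z \<le> dist x w))"

text \<open>Only meaningful for nonempty bounded sets, since the suprema are taken in \<open>real\<close>.\<close>

definition hausdorff_dist :: "'a::metric_space set \<Rightarrow> 'a set \<Rightarrow> real" where
  "hausdorff_dist A B = max (SUP x\<in>A. infdist x B) (SUP x\<in>B. infdist x A)"

definition fixed_points :: "'a set \<Rightarrow> ('a \<Rightarrow> 'a set) \<Rightarrow> 'a set" where
  "fixed_points K T = {x \<in> K. x \<in> T x}"

definition gen_hybrid_II ::
    "'a::metric_space set \<Rightarrow> ('a \<Rightarrow> 'a set) \<Rightarrow>
     ('a \<Rightarrow> real) \<Rightarrow> ('a \<Rightarrow> real) \<Rightarrow> ('a \<Rightarrow> real) \<Rightarrow> ('a \<Rightarrow> real) \<Rightarrow> ('a \<Rightarrow> real) \<Rightarrow> bool" where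
  "gen_hybrid_II K T a1 a2 a3 k1 k2 \<longleftrightarrow>
     (\<forall>x\<in>K. a1 x \<in> {0..1} \<and> a2 x \<in> {0..1} \<and> a3 x \<in> {0..1} \<and> k1 x \<in> {0..1} \<and> k2 x \<in> {0..1}) \<and>
     (\<forall>x\<in>K. a1 x + a2 x + a3 x < 1 \<and> 2 * k1 x < 1 - a2 x \<and> 2 * k2 x < 1 - a3 x) \<and>
     (\<forall>x\<in>K. \<forall>y\<in>K.
        (hausdorff_dist (T x) (T y))\<^sup>2 \<le>
          a1 x * (dist x y)\<^sup>2 + a2 x * (infdist y (T x))\<^sup>2 + a3 x * (infdist x (T y))\<^sup>2 +
          k1 x * (infdist x (T x))\<^sup>2 + k2 x * (infdist y (T y))\<^sup>2)"

definition asymp_radius_at :: "'a::metric_space \<Rightarrow> (nat \<Rightarrow> 'a) \<Rightarrow> ereal" where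
  "asymp_radius_at x u = limsup (\<lambda>n. ereal (dist x (u n)))"

definition asymp_radius :: "(nat \<Rightarrow> 'a::metric_space) \<Rightarrow> ereal" where
  "asymp_radius u = (INF x. asymp_radius_at x u)"

definition asymp_center :: "(nat \<Rightarrow> 'a::metric_space) \<Rightarrow> 'a set" where
  "asymp_center u = {x. asymp_radius_at x u = asymp_radius u}"

definition delta_converges :: "(nat \<Rightarrow> 'a::metric_space) \<Rightarrow> 'a \<Rightarrow> bool" where
  "delta_converges u x \<longleftrightarrow>
     bounded (range u) \<and> (\<forall>\<sigma>. strict_mono \<sigma> \<longrightarrow> asymp_center (u \<circ> \<sigma>) = {x})"

end

theory Submission
  imports Defs
begin

text \<open>
  Let \<open>p\<close> be a fixed point of \<open>T\<close> with \<open>T p = {p}\<close>. The iteration contracts the distance to \<open>p\<close>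
  by a uniform factor from some index on, so \<open>x n\<close> tends to \<open>p\<close> in the metric; a metric limit is a
  \<open>\<Delta>\<close>-limit (\<open>tendsto_imp_delta_converges\<close>). In particular \<open>p\<close> is the only fixed point. The
  contraction has three sources.

  First, writing the hybrid inequality for the pair \<open>p\<close>, \<open>z\<close> and absorbing the term
  \<open>d(p, Tz) \<le> H(Tp, Tz)\<close> into the left-hand side gives, for every \<open>w \<in> T z\<close>,
  \<open>d(w, p)\<^sup>2 \<le> \<theta> d(z, p)\<^sup>2 + c d(z, w)\<^sup>2\<close> with \<open>\<theta> = (a1 p + a2 p) / (1 - a3 p) < 1\<close> and
  \<open>c = k2 p / (1 - a3 p)\<close> (\<open>gen_hybrid_II_strict_fixed_point_le\<close>).

  Second, in a CAT(\<open>\<kappa>\<close>) space of diameter at most \<open>\<rho> / sqrt \<kappa>\<close> with \<open>\<rho> < pi / 2\<close>, the function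
  \<open>d(_, p)\<^sup>2\<close> is uniformly convex along geodesics with constant \<open>\<rho> cot \<rho>\<close>
  (\<open>geodesic_point_sq_dist_le\<close>). Here \<open>\<rho> = (pi - \<epsilon>) / 2\<close>, and the constant \<open>\<rho> cot \<rho>\<close> is in general
  smaller than \<open>R / 2\<close>: for small \<open>\<epsilon>\<close> it is only about half of it. It is never less than \<open>R / 4\<close>
  (\<open>convexity_constant_bound\<close>), and that is enough, because the lower limits in the theorem
  are taken with \<open>2 c\<close> and not \<open>c\<close>: positivity of \<open>(1 - \<beta>) R / 2 - 2 c\<close> is the same as
  \<open>c < (1 - \<beta>) R / 4\<close>. So the term \<open>c d(z, w)\<^sup>2\<close> of the first point is compensated by the uniform
  convexity, and what remains is the factor \<open>1 - \<beta> (1 - \<theta>)\<close>, with \<open>\<beta>\<close> bounded away from \<open>0\<close>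
  (\<open>weighted_step_contraction\<close>).

  Third, the metric projection onto \<open>K\<close> does not increase the distance to points of \<open>K\<close>
  (\<open>metric_proj_dist_le\<close>).

  All the geometry of the space is drawn from one consequence of the comparison axiom,
  \<open>sine_inequality\<close>, which bounds the cosine of the distance from a point of a side to the opposite
  vertex. It yields the uniqueness of the points \<open>(1 - t) x \<oplus> t y\<close> and of nearest points, and
  the inequalities of the second and third points.
\<close>

section \<open>Trigonometric inequalities\<close>

lemma sin_sq_add_identity:
  fixes a b :: real
  shows "(sin a)\<^sup>2 + (sin b)\<^sup>2 + 2 * sin a * sin b * cos (a + b) = (sin (a + b))\<^sup>2"
  using sin_cos_squared_add[of a] sin_cos_squared_add[of b]
  unfolding sin_add cos_add by algebra

text \<open>Cauchy--Schwarz in the plane; the defect is the square of the derivative in \<open>s\<close>.\<close>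
lemma cos_sin_combination_sq_le:
  fixes A B s :: real
  shows "(A * cos s + B * sin s)\<^sup>2 \<le> A\<^sup>2 + B\<^sup>2"
proof -
  have "(A * cos s + B * sin s)\<^sup>2 + (B * cos s - A * sin s)\<^sup>2 = A\<^sup>2 + B\<^sup>2"
    using sin_cos_squared_add[of s] by algebra
  then show ?thesis using zero_le_power2[of "B * cos s - A * sin s"] by linarith
qed

lemma mult_cot_antimono:
  fixes x y :: real
  assumes "0 < x" "x \<le> y" "y < pi"
  shows "y * cot y \<le> x * cot x"
proof (rule DERIV_nonpos_imp_nonincreasing[OF assms(2)])
  fix t :: real assume t: "x \<le> t" "t \<le> y"
  then have s: "sin t > 0" using assms by (intro sin_gt_zero) auto
  have "((\<lambda>x. x * cot x) has_real_derivative cot t - t * inverse ((sin t)\<^sup>2)) (at t)"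
    using s by (auto intro!: derivative_eq_intros DERIV_cot)
  moreover have "cot t - t * inverse ((sin t)\<^sup>2) = (sin t * cos t - t) / (sin t)\<^sup>2"
    using s by (simp add: cot_def field_simps power2_eq_square)
  moreover have "sin t * cos t \<le> t"
  proof -
    have "sin (2 * t) \<le> 2 * t" using t assms by (intro sin_x_le_x) auto
    then show ?thesis by (simp add: sin_double)
  qed
  ultimately show "\<exists>D. ((\<lambda>x. x * cot x) has_real_derivative D) (at t) \<and> D \<le> 0"
    by (intro exI[of _ "cot t - t * inverse ((sin t)\<^sup>2)"]) (auto intro: divide_nonpos_nonneg)
qed

text \<open>
  With \<open>s = \<epsilon> / 2\<close> and \<open>\<rho> = pi / 2 - s\<close> the right-hand side is \<open>\<rho> tan s\<close>, and by the formula for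
  \<open>tan (2 s)\<close> the claim becomes \<open>\<rho> tan s \<le> s cot s\<close>. As \<open>tan s = cot \<rho>\<close> and \<open>s \<le> \<rho>\<close>, this is
  the monotonicity of \<open>x cot x\<close>. Both sides are asymptotic to \<open>pi * \<epsilon> / 4\<close> as \<open>\<epsilon>\<close> tends to \<open>0\<close>, so
  the factor \<open>1 / 4\<close> cannot be improved.
\<close>
lemma convexity_constant_bound:
  fixes \<epsilon> :: real
  assumes "0 < \<epsilon>" "\<epsilon> < pi / 2"
  shows "(pi - 2 * \<epsilon>) * tan \<epsilon> / 4 \<le> (pi - \<epsilon>) / 2 * cot ((pi - \<epsilon>) / 2)"
proof -
  define s where "s = \<epsilon> / 2"
  define r where "r = pi / 2 - s"
  have s: "0 < s" "s < pi / 4" and e: "\<epsilon> = 2 * s" using assms by (auto simp: s_def)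
  have c: "cos s > 0" and sn: "sin s > 0" using s by (auto intro!: cos_gt_zero sin_gt_zero)
  have c2: "cos (2 * s) > 0" using s by (intro cos_gt_zero) auto
  have cotr: "cot r = tan s" by (simp add: r_def cot_def tan_def sin_diff cos_diff)
  have "r * cot r \<le> s * cot s" by (rule mult_cot_antimono) (use s in \<open>auto simp: r_def\<close>)
  then have "r * (sin s / cos s) \<le> s * (cos s / sin s)" by (simp add: cotr) (simp add: tan_def cot_def)
  then have *: "r * (sin s)\<^sup>2 \<le> s * (cos s)\<^sup>2"
    using c sn by (simp add: field_simps power2_eq_square)
  have "(pi / 2 - 2 * s) * (cos s)\<^sup>2 \<le> r * cos (2 * s)"
    using * unfolding cos_double r_def by (simp add: algebra_simps)
  then have "(pi / 2 - 2 * s) * (cos s)\<^sup>2 * sin s \<le> r * cos (2 * s) * sin s"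
    using sn by (intro mult_right_mono) auto
  then have "(pi / 2 - 2 * s) * (cos s * sin s / cos (2 * s)) \<le> r * (sin s / cos s)"
    using c c2 by (simp add: field_simps power2_eq_square)
  moreover have "(pi - 2 * \<epsilon>) * tan \<epsilon> / 4 = (pi / 2 - 2 * s) * (cos s * sin s / cos (2 * s))"
    using c2 unfolding e tan_def sin_double by (simp add: field_simps)
  moreover have "(pi - \<epsilon>) / 2 * cot ((pi - \<epsilon>) / 2) = r * (sin s / cos s)"
    using cotr by (simp add: e r_def field_simps tan_def)
  ultimately show ?thesis by simp
qed

lemma mult_cos_le_sin:
  fixes x :: real
  assumes "0 \<le> x" "x \<le> pi"
  shows "x * cos x \<le> sin x"
proof -
  have "(\<lambda>x. sin x - x * cos x) 0 \<le> sin x - x * cos x"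
  proof (rule DERIV_nonneg_imp_nondecreasing[OF assms(1)])
    fix t :: real assume t: "0 \<le> t" "t \<le> x"
    have "((\<lambda>x. sin x - x * cos x) has_real_derivative t * sin t) (at t)"
      by (auto intro!: derivative_eq_intros)
    moreover have "0 \<le> t * sin t" using t assms by (intro mult_nonneg_nonneg sin_ge_zero) auto
    ultimately show "\<exists>D. ((\<lambda>x. sin x - x * cos x) has_real_derivative D) (at t) \<and> 0 \<le> D" by blast
  qed
  then show ?thesis by simp
qed

section \<open>Uniform convexity of the squared spherical distance\<close>

text \<open>
  Along a great circle parametrized by arc length, the cosine of the distance \<open>m\<close> to a fixed point
  of the sphere is \<open>w s = A * cos s + B * sin s\<close>. Since \<open>w'' = - w\<close>, the second derivative of \<open>m\<^sup>2\<close>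
  is \<open>2 m cot m\<close> plus a nonnegative multiple of \<open>w'\<^sup>2\<close>, and \<open>m cot m \<ge> \<rho> cot \<rho>\<close> as long as
  \<open>m \<le> \<rho>\<close>. The strict inequality \<open>A\<^sup>2 + B\<^sup>2 < 1\<close> keeps \<open>w s\<close> away from \<open>1\<close>, where \<open>arccos\<close> is not
  differentiable.
\<close>
lemma arccos_sq_convex_open:
  fixes A B l \<rho> :: real
  assumes AB: "A\<^sup>2 + B\<^sup>2 < 1" and \<rho>: "0 < \<rho>" "\<rho> < pi / 2"
    and low: "\<And>s. s \<in> {0..l} \<Longrightarrow> cos \<rho> \<le> A * cos s + B * sin s"
  shows "convex_on {0..l} (\<lambda>s. (arccos (A * cos s + B * sin s))\<^sup>2 - \<rho> * cot \<rho> * s\<^sup>2)"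
proof -
  define w w' where "w = (\<lambda>s. A * cos s + B * sin s)" and "w' = (\<lambda>s. B * cos s - A * sin s)"
  define m where "m = (\<lambda>s. arccos (w s))"
  define k where "k = \<rho> * cot \<rho>"
  have w1: "\<bar>w s\<bar> < 1" for s
  using cos_sin_combination_sq_le[of A s B] AB abs_square_less_1[of "w s"]
    by (simp add: w_def)
  have Dw: "(w has_real_derivative w' s) (at s)" "(w' has_real_derivative - w s) (at s)" for s
    unfolding w_def w'_def by (auto intro!: derivative_eq_intros)
  have m0: "0 < m s" "m s < pi" for s
    using w1[of s] arccos_lt_bounded[of "w s"] by (auto simp: m_def)
  have sinm: "sin (m s) > 0" for s using m0 by (intro sin_gt_zero)
  have cosm: "cos (m s) = w s" for s using w1[of s] by (simp add: m_def cos_arccos_abs)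
  have Dm: "(m has_real_derivative - w' s / sin (m s)) (at s)" for s
  proof -
    have "sin (m s) = sqrt (1 - (w s)\<^sup>2)" using w1[of s] unfolding m_def by (intro sin_arccos) auto
    then show ?thesis unfolding m_def using w1[of s]
      by (auto intro!: derivative_eq_intros Dw simp: field_simps)
  qed
  have D1: "((\<lambda>s. (m s)\<^sup>2 - k * s\<^sup>2) has_real_derivative - 2 * m s * w' s / sin (m s) - 2 * k * s) (at s)" for s
    using sinm[of s] by (auto intro!: derivative_eq_intros Dm)
  define g where "g = (\<lambda>s. 2 * (w' s)\<^sup>2 * (sin (m s) - m s * cos (m s)) / sin (m s) ^ 3
      + 2 * (m s * cot (m s) - k))"
  have D2: "((\<lambda>s. - 2 * m s * w' s / sin (m s) - 2 * k * s) has_real_derivative g s) (at s)" for s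
    unfolding g_def using sinm[of s]
    by (auto intro!: derivative_eq_intros Dm Dw
        simp: cosm cot_def field_simps power2_eq_square power3_eq_cube)
  have "convex_on {0..l} (\<lambda>s. (m s)\<^sup>2 - k * s\<^sup>2)"
  proof (rule f''_ge0_imp_convex[OF _ D1 D2])
    fix s assume s: "s \<in> {0..l}"
    have "m s \<le> \<rho>"
    proof (rule ccontr)
      assume "\<not> m s \<le> \<rho>"
      then have "cos (m s) < cos \<rho>" using m0[of s] \<rho> by (intro cos_monotone_0_pi) auto
      then show False using low[OF s] cosm[of s] by (simp add: w_def)
    qed
    then have "k \<le> m s * cot (m s)" unfolding k_def
      using m0 \<rho> by (intro mult_cot_antimono) auto
    moreover have "m s * cos (m s) \<le> sin (m s)" using m0[of s] by (intro mult_cos_le_sin) auto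
    ultimately show "0 \<le> g s" unfolding g_def using sinm[of s]
      by (intro add_nonneg_nonneg mult_nonneg_nonneg divide_nonneg_nonneg) auto
  qed simp
  then show ?thesis by (simp add: m_def w_def k_def)
qed

text \<open>
  The boundary case \<open>A\<^sup>2 + B\<^sup>2 = 1\<close>, a great circle through the fixed point, is reached by scaling
  \<open>A\<close>, \<open>B\<close> and \<open>cos \<rho>\<close> by a factor \<open>h < 1\<close> and letting \<open>h\<close> tend to \<open>1\<close>.
\<close>
lemma arccos_sq_convex:
  fixes A B l \<rho> t :: real
  assumes AB: "A\<^sup>2 + B\<^sup>2 \<le> 1" and \<rho>: "0 < \<rho>" "\<rho> < pi / 2" and l: "0 \<le> l" and t: "t \<in> {0..1}"
    and low: "\<And>s. s \<in> {0..l} \<Longrightarrow> cos \<rho> \<le> A * cos s + B * sin s"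
  defines "w \<equiv> \<lambda>s. A * cos s + B * sin s"
  shows "(arccos (w (t * l)))\<^sup>2 \<le>
    (1 - t) * (arccos (w 0))\<^sup>2 + t * (arccos (w l))\<^sup>2 - \<rho> * cot \<rho> * (t * (1 - t) * l\<^sup>2)"
proof -
  have w1: "\<bar>w s\<bar> \<le> 1" for s
  using cos_sin_combination_sq_le[of A s B] AB abs_square_le_1[of "w s"]
    by (simp add: w_def)
  have cr: "0 < cos \<rho>" "cos \<rho> < 1" 
    using \<rho> cos_monotone_0_pi[of 0 \<rho>] by (auto intro: cos_gt_zero)
  (* F h is the right-hand side minus the left-hand side for the data scaled by h. *)
  define F where "F = (\<lambda>h. (1 - t) * (arccos (h * w 0))\<^sup>2 + t * (arccos (h * w l))\<^sup>2
     - arccos (h * cos \<rho>) * cot (arccos (h * cos \<rho>)) * (t * (1 - t) * l\<^sup>2) - (arccos (h * w (t * l)))\<^sup>2)"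
  have pos: "0 \<le> F h" if h: "0 < h" "h < 1" for h
  proof -
    define r where "r = arccos (h * cos \<rho>)"
    have hc: "0 < h * cos \<rho>" "h * cos \<rho> < 1" using h cr mult_strict_mono[of h 1 "cos \<rho>" 1] by auto
    have r: "0 < r" "r < pi / 2"
    proof -
      show "0 < r" using arccos_lt_bounded[of "h * cos \<rho>"] hc by (simp add: r_def)
      show "r < pi / 2" using hc arccos_less_arccos[of 0 "h * cos \<rho>"] by (simp add: r_def)
    qed
    have "convex_on {0..l} (\<lambda>s. (arccos (h * A * cos s + h * B * sin s))\<^sup>2 - r * cot r * s\<^sup>2)"
    proof (rule arccos_sq_convex_open[OF _ r])
      have "(h * A)\<^sup>2 + (h * B)\<^sup>2 = h\<^sup>2 * (A\<^sup>2 + B\<^sup>2)" by (simp add: power_mult_distrib algebra_simps)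
      also have "\<dots> \<le> h\<^sup>2 * 1" using AB by (intro mult_left_mono) auto
      also have "\<dots> < 1" using h by (simp add: power_less_one_iff abs_square_less_1)
      finally show "(h * A)\<^sup>2 + (h * B)\<^sup>2 < 1" .
      fix s assume "s \<in> {0..l}"
      then have "h * cos \<rho> \<le> h * (A * cos s + B * sin s)" using low h by (intro mult_left_mono) auto
      moreover have "cos r = h * cos \<rho>" using hc by (simp add: r_def cos_arccos_abs)
      ultimately show "cos r \<le> h * A * cos s + h * B * sin s" by (simp add: algebra_simps)
    qed
    from convex_onD[OF this, of t 0 l] t l
    show ?thesis unfolding F_def r_def[symmetric] 
      by (simp add: w_def algebra_simps power2_eq_square)
  qed
  have "(F \<longlongrightarrow> F 1) (at_left 1)"
  proof -
    have ar: "((\<lambda>h. arccos (h * c)) \<longlongrightarrow> arccos (1 * c)) (at_left (1::real))" if "\<bar>c\<bar> \<le> 1" for c :: real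
    proof (rule continuous_on_tendsto_compose[OF continuous_on_arccos'])
      show "((\<lambda>h. h * c) \<longlongrightarrow> 1 * c) (at_left (1::real))" by (intro tendsto_intros)
      show "1 * c \<in> {- 1..1}" using that by auto
      have "\<forall>\<^sub>F h in at_left (1::real). h \<in> {0<..<1}"
        by (rule eventually_at_leftI[of 0]) auto
      then show "\<forall>\<^sub>F h in at_left (1::real). h * c \<in> {- 1..1}"
      proof eventually_elim
        case (elim h)
        have "\<bar>h * c\<bar> \<le> 1 * 1" unfolding abs_mult using elim that by (intro mult_mono) auto
        then show ?case by auto
      qed
    qed
    have "arccos (1 * cos \<rho>) = \<rho>" using \<rho> by (simp add: arccos_cos)
    moreover have "sin \<rho> \<noteq> 0" using \<rho> sin_gt_zero[of \<rho>] by auto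
    ultimately show ?thesis unfolding F_def
      by (intro tendsto_intros ar w1) (use cr in auto)
  qed
  moreover have "\<forall>\<^sub>F h in at_left 1. 0 \<le> F h"
    by (rule eventually_at_leftI[of 0]) (use pos in auto)
  ultimately have "0 \<le> F 1" by (intro tendsto_lowerbound) auto
  then show ?thesis using \<rho> by (simp add: F_def arccos_cos)
qed

text \<open>
  The numbers \<open>a\<close>, \<open>b\<close>, \<open>l\<close> are the sides of a small spherical triangle, and \<open>m\<close> is at most the
  distance from the vertex opposite to the side \<open>l\<close> to the point that divides this side in the
  ratio \<open>t : 1 - t\<close>. The triangle inequalities say that the cosines along the side come from
  coefficients with \<open>A\<^sup>2 + B\<^sup>2 \<le> 1\<close>, by the spherical law of cosines.
\<close>
lemma spherical_comparison_sq_le: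
  fixes a b l m t \<rho> :: real
  assumes \<rho>: "\<rho> < pi / 2" and l: "0 < l" "l \<le> \<rho>" and a: "0 \<le> a" "a \<le> \<rho>" and b: "0 \<le> b" "b \<le> \<rho>"
    and tri: "\<bar>a - l\<bar> \<le> b" "b \<le> a + l" and t: "t \<in> {0..1}" and m: "0 \<le> m" "m \<le> pi"
    and le: "sin ((1 - t) * l) * cos a + sin (t * l) * cos b \<le> sin l * cos m"
  shows "m\<^sup>2 \<le> (1 - t) * a\<^sup>2 + t * b\<^sup>2 - \<rho> * cot \<rho> * (t * (1 - t) * l\<^sup>2)"
proof -
  define A where "A = cos a"
  define B where "B = (cos b - cos a * cos l) / sin l"
  define w where "w = (\<lambda>s. A * cos s + B * sin s)"
  have sl: "sin l > 0" using l \<rho> by (intro sin_gt_zero) auto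
  have w: "sin l * w s = sin (l - s) * cos a + sin s * cos b" for s
    using sl by (simp add: w_def A_def B_def sin_diff field_simps)
  (* By the law of cosines B is sin a times the cosine of an angle, so it is at most sin a. *)
  have "\<bar>cos b - cos a * cos l\<bar> \<le> sin a * sin l"
  proof -
    have "cos (a + l) \<le> cos b" using tri a b l \<rho> by (intro cos_monotone_0_pi_le) auto
    moreover have "cos b \<le> cos \<bar>a - l\<bar>" using tri a b l \<rho> by (intro cos_monotone_0_pi_le) auto
    ultimately show ?thesis by (simp add: cos_add cos_diff)
  qed
  then have "\<bar>B\<bar> \<le> sin a" using sl by (simp add: B_def field_simps)
  then have "B\<^sup>2 \<le> (sin a)\<^sup>2" by (metis abs_ge_zero power2_abs power_mono)
  then have AB: "A\<^sup>2 + B\<^sup>2 \<le> 1" using sin_cos_squared_add[of a] unfolding A_def by linarith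
  have low: "cos \<rho> \<le> w s" if s: "s \<in> {0..l}" for s
  proof -
    have "sin (l - s) \<ge> 0" "sin s \<ge> 0" using s l \<rho> by (auto intro!: sin_ge_zero)
    moreover have "cos \<rho> \<le> cos a" "cos \<rho> \<le> cos b"
      using a b \<rho> by (auto intro!: cos_monotone_0_pi_le)
    ultimately have "sin (l - s) * cos \<rho> + sin s * cos \<rho> \<le> sin l * w s"
      unfolding w by (intro add_mono mult_left_mono)
    moreover have "sin l * cos \<rho> \<le> (sin (l - s) + sin s) * cos \<rho>"
    proof (rule mult_right_mono)
      have "sin l = sin (l - s) * cos s + cos (l - s) * sin s" by (simp add: sin_add[symmetric])
      also have "\<dots> \<le> sin (l - s) * 1 + 1 * sin s"
        using \<open>sin (l - s) \<ge> 0\<close> \<open>sin s \<ge> 0\<close> by (intro add_mono mult_left_mono mult_right_mono) auto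
      finally show "sin l \<le> sin (l - s) + sin s" by simp
      show "0 \<le> cos \<rho>" using l \<rho> by (intro cos_ge_zero) auto
    qed
    ultimately have "sin l * cos \<rho> \<le> sin l * w s" by (simp add: algebra_simps)
    then show ?thesis using sl by simp
  qed
  have "w 0 = cos a" by (simp add: w_def A_def)
  then have w0: "arccos (w 0) = a" using a \<rho> by (simp add: arccos_cos)
  have "w l = cos b" using sl w[of l] by simp
  then have wl: "arccos (w l) = b" using b \<rho> by (simp add: arccos_cos)
  have "(arccos (w (t * l)))\<^sup>2 \<le>
      (1 - t) * (arccos (w 0))\<^sup>2 + t * (arccos (w l))\<^sup>2 - \<rho> * cot \<rho> * (t * (1 - t) * l\<^sup>2)"
    unfolding w_def by (rule arccos_sq_convex[OF AB _ \<rho> _ t low[unfolded w_def]]) (use l in auto)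
  then have "(arccos (w (t * l)))\<^sup>2 \<le> (1 - t) * a\<^sup>2 + t * b\<^sup>2 - \<rho> * cot \<rho> * (t * (1 - t) * l\<^sup>2)"
    by (simp only: w0 wl)
  moreover have "m \<le> arccos (w (t * l))"
  proof -
    have "sin l * w (t * l) \<le> sin l * cos m" using le unfolding w by (simp add: algebra_simps)
    then have "w (t * l) \<le> cos m" using sl by simp
    moreover have "0 \<le> cos \<rho>" using l \<rho> by (intro cos_ge_zero) auto
    then have "-1 \<le> w (t * l)" using low[of "t * l"] t l by (simp add: mult_le_cancel_right1)
    ultimately have "arccos (cos m) \<le> arccos (w (t * l))" by (intro arccos_le_arccos) auto
    then show ?thesis using m by (simp add: arccos_cos)
  qed
  then have "m\<^sup>2 \<le> (arccos (w (t * l)))\<^sup>2" using m by (intro power_mono)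
  ultimately show ?thesis by linarith
qed

section \<open>Geodesic segments and the model sphere\<close>

lemma geodesic_segmentD:
  assumes "geodesic_segment M d x y S" "z \<in> S"
  shows "z \<in> M" "0 \<le> d x z" "d x z \<le> d x y" "d z y = d x y - d x z"
proof -
  obtain c where c: "c \<in> {0..d x y} \<rightarrow> M" "c 0 = x" "c (d x y) = y"
    "\<And>s t. s \<in> {0..d x y} \<Longrightarrow> t \<in> {0..d x y} \<Longrightarrow> d (c s) (c t) = \<bar>s - t\<bar>" "S = c ` {0..d x y}"
    using assms(1) unfolding geodesic_segment_def by metis
  obtain s where s: "s \<in> {0..d x y}" "z = c s" using assms(2) c(5) by auto
  have "d x z = s" using c(4)[of 0 s] c(2) s by auto
  moreover have "d z y = d x y - s" using c(4)[of s "d x y"] c(3) s by auto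
  ultimately show "z \<in> M" "0 \<le> d x z" "d x z \<le> d x y" "d z y = d x y - d x z"
    using s c(1) by auto
qed

lemma geodesic_segment_point_at:
  assumes "geodesic_segment M d x y S" "s \<in> {0..d x y}"
  shows "\<exists>z\<in>S. d x z = s"
proof -
  obtain c where c: "c 0 = x" "S = c ` {0..d x y}"
    "\<And>s t. s \<in> {0..d x y} \<Longrightarrow> t \<in> {0..d x y} \<Longrightarrow> d (c s) (c t) = \<bar>s - t\<bar>"
    using assms(1) unfolding geodesic_segment_def by metis
  have "d x (c s) = s" using c(3)[of 0 s] c(1) assms(2) by auto
  then show ?thesis using c(2) assms(2) by blast
qed

lemma geodesic_segment_endpoints:
  assumes "geodesic_segment M d x y S" "0 \<le> d x y"
  shows "x \<in> S" "y \<in> S"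
  using assms unfolding geodesic_segment_def by (metis atLeastAtMost_iff imageI order_refl)+

lemma cos_model_dist:
  assumes "\<kappa> > 0" "p \<in> model_carrier" "q \<in> model_carrier"
  shows "cos (sqrt \<kappa> * model_dist \<kappa> p q) = p \<bullet> q"
proof -
  have "\<bar>p \<bullet> q\<bar> \<le> 1"
    using Cauchy_Schwarz_ineq2[of p q] assms(2,3) by (simp add: model_carrier_def)
  then show ?thesis using assms(1) by (simp add: model_dist_def cos_arccos_abs)
qed

lemma model_dist_bounds:
  assumes "\<kappa> > 0" "p \<in> model_carrier" "q \<in> model_carrier"
  shows "0 \<le> sqrt \<kappa> * model_dist \<kappa> p q" "sqrt \<kappa> * model_dist \<kappa> p q \<le> pi"
proof -
  have "\<bar>p \<bullet> q\<bar> \<le> 1"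
    using Cauchy_Schwarz_ineq2[of p q] assms(2,3) by (simp add: model_carrier_def)
  then show "0 \<le> sqrt \<kappa> * model_dist \<kappa> p q" "sqrt \<kappa> * model_dist \<kappa> p q \<le> pi"
    using assms(1) arccos_bounded[of "p \<bullet> q"] by (auto simp: model_dist_def)
qed

text \<open>
  Points of a minimal geodesic are determined by their distances to its ends: the difference of the
  two sides has squared norm zero, by \<open>sin_sq_add_identity\<close>.
\<close>
lemma sphere_geodesic_point:
  fixes p q z :: "'v::real_inner"
  assumes "norm p = 1" "norm q = 1" "norm z = 1"
    and "p \<bullet> z = cos a" "z \<bullet> q = cos b" "p \<bullet> q = cos (a + b)"
  shows "sin (a + b) *\<^sub>R z = sin b *\<^sub>R p + sin a *\<^sub>R q"
proof -
  let ?w = "sin (a + b) *\<^sub>R z - (sin b *\<^sub>R p + sin a *\<^sub>R q)"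
  have sq: "p \<bullet> p = 1" "q \<bullet> q = 1" "z \<bullet> z = 1"
    using assms(1-3) by (simp_all add: dot_square_norm)
  have com: "z \<bullet> p = cos a" "q \<bullet> z = cos b" "q \<bullet> p = cos (a + b)"
    using assms by (simp_all add: inner_commute)
  have "?w \<bullet> ?w = (sin (a + b))\<^sup>2 + ((sin a)\<^sup>2 + (sin b)\<^sup>2 + 2 * sin a * sin b * cos (a + b))
      - 2 * sin (a + b) * (sin a * cos b + cos a * sin b)"
    by (simp add: inner_diff inner_add sq com assms(4-6) power2_eq_square algebra_simps)
  also have "\<dots> = (sin (a + b))\<^sup>2 + (sin (a + b))\<^sup>2 - 2 * sin (a + b) * sin (a + b)"
    by (simp only: sin_sq_add_identity sin_add[symmetric])
  also have "\<dots> = 0" by (simp add: power2_eq_square)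
  finally show ?thesis by simp
qed

lemma model_sine_equality:
  assumes \<kappa>: "\<kappa> > 0" and p: "p \<in> model_carrier" and q: "q \<in> model_carrier"
    and seg: "geodesic_segment model_carrier (model_dist \<kappa>) p q S" and z: "z \<in> S"
  defines "k \<equiv> sqrt \<kappa>"
  shows "sin (k * model_dist \<kappa> p q) * (z \<bullet> r) =
    sin (k * model_dist \<kappa> z q) * (p \<bullet> r) + sin (k * model_dist \<kappa> p z) * (q \<bullet> r)"
proof -
  let ?a = "k * model_dist \<kappa> p z" and ?b = "k * model_dist \<kappa> z q"
  note zs = geodesic_segmentD[OF seg z]
  have ab: "?a + ?b = k * model_dist \<kappa> p q" unfolding zs(4) by (simp add: algebra_simps)
  have "sin (?a + ?b) *\<^sub>R z = sin ?b *\<^sub>R p + sin ?a *\<^sub>R q"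
  proof (rule sphere_geodesic_point)
    show "norm p = 1" "norm q = 1" "norm z = 1"
      using p q zs(1) by (auto simp: model_carrier_def)
    show "p \<bullet> z = cos ?a" "z \<bullet> q = cos ?b"
      unfolding k_def using cos_model_dist[OF \<kappa>] p q zs(1) by auto
    show "p \<bullet> q = cos (?a + ?b)" unfolding ab unfolding k_def using cos_model_dist[OF \<kappa> p q] by simp
  qed
  then have "(sin (?a + ?b) *\<^sub>R z) \<bullet> r = (sin ?b *\<^sub>R p + sin ?a *\<^sub>R q) \<bullet> r" by (rule arg_cong)
  then show ?thesis unfolding ab by (simp add: inner_add_left)
qed

section \<open>Small CAT(\<open>\<kappa>\<close>) spaces\<close>

context
  fixes \<kappa> \<rho> :: real
  assumes \<kappa>: "\<kappa> > 0" and \<rho>: "\<rho> < pi / 2"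
    and cat: "CAT_space \<kappa> (UNIV :: 'a::metric_space set) dist"
    and small: "\<And>p q :: 'a. sqrt \<kappa> * dist p q \<le> \<rho>"
begin

lemma scaled_dist_bounds:
  fixes p q :: 'a
  shows "0 \<le> sqrt \<kappa> * dist p q" "sqrt \<kappa> * dist p q < pi / 2" "sqrt \<kappa> * dist p q < pi"
proof -
  show "0 \<le> sqrt \<kappa> * dist p q" using \<kappa> by simp
  show "sqrt \<kappa> * dist p q < pi / 2" "sqrt \<kappa> * dist p q < pi"
    using small[of p q] \<rho> pi_gt_zero by linarith+
qed

lemma geodesic_exists: "\<exists>S. geodesic_segment UNIV dist (p :: 'a) q S"
proof -
  have "dist p q < pi / sqrt \<kappa>" using \<kappa> scaled_dist_bounds(3)[of p q] by (simp add: field_simps)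
  then show ?thesis using cat by (auto simp: CAT_space_def)
qed

text \<open>
  The cosine of the distance from the vertex \<open>r\<close> to a point of the opposite side is at least its
  value in the comparison triangle, where it is a combination of the cosines at the two ends with
  sine weights. In this form the comparison axiom no longer mentions the model surface.
\<close>
lemma sine_inequality:
  fixes x y z r :: 'a
  assumes seg: "geodesic_segment UNIV dist x y S" and z: "z \<in> S"
  defines "k \<equiv> sqrt \<kappa>"
  shows "sin (k * dist z y) * cos (k * dist x r) + sin (k * dist x z) * cos (k * dist y r)
      \<le> sin (k * dist x y) * cos (k * dist z r)"
proof -
  have k: "k > 0" using \<kappa> by (simp add: k_def)
  obtain B C where BC: "geodesic_segment UNIV dist y r B" "geodesic_segment UNIV dist r x C"
    using geodesic_exists by metis
  have "k * (dist x y + dist y r + dist r x) < 2 * pi"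
    using scaled_dist_bounds(2)[of x y] scaled_dist_bounds(2)[of y r] scaled_dist_bounds(2)[of r x]
      pi_gt_zero unfolding k_def distrib_left by linarith
  then have "dist x y + dist y r + dist r x < 2 * (pi / sqrt \<kappa>)"
    using k by (simp add: k_def field_simps)
  then obtain p q r' A' B' C' where
    cmp: "comparison_triangle \<kappa> dist x y r p q r' A' B' C'" and
    le: "\<And>v w v' w'. comparison_point \<kappa> dist x y r S B C p q r' A' B' C' v v' \<Longrightarrow>
       comparison_point \<kappa> dist x y r S B C p q r' A' B' C' w w' \<Longrightarrow> dist v w \<le> model_dist \<kappa> v' w'"
    using cat seg BC unfolding CAT_space_def geodesic_triangle_def by (metis (no_types) UNIV_I)
  have segs: "geodesic_segment model_carrier (model_dist \<kappa>) p q A'"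
    "geodesic_segment model_carrier (model_dist \<kappa>) q r' B'"
    "geodesic_segment model_carrier (model_dist \<kappa>) r' p C'"
    and ds: "model_dist \<kappa> p q = dist x y" "model_dist \<kappa> q r' = dist y r" "model_dist \<kappa> r' p = dist r x"
    using cmp by (auto simp: comparison_triangle_def geodesic_triangle_def)
  have pC: "r' \<in> C'" "p \<in> C'" "q \<in> B'"
    using geodesic_segment_endpoints[OF segs(2)] geodesic_segment_endpoints[OF segs(3)] ds by auto
  have car: "p \<in> model_carrier" "q \<in> model_carrier" "r' \<in> model_carrier"
    using pC geodesic_segmentD(1)[OF segs(2)] geodesic_segmentD(1)[OF segs(3)] by auto
  note zs = geodesic_segmentD[OF seg z]
  obtain z' where z': "z' \<in> A'" "model_dist \<kappa> p z' = dist x z"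
    using geodesic_segment_point_at[OF segs(1), of "dist x z"] zs ds by auto
  note zs' = geodesic_segmentD[OF segs(1) z'(1)]
  have zq: "model_dist \<kappa> z' q = dist z y" using zs' zs ds z' by simp
  have "model_dist \<kappa> r' r' = 0"
    using car by (simp add: model_dist_def model_carrier_def dot_square_norm)
  moreover have "r \<in> C" using geodesic_segment_endpoints[OF BC(2)] by simp
  ultimately have "dist z r \<le> model_dist \<kappa> z' r'"
    by (intro le) (use z z' pC in \<open>auto simp: comparison_point_def side_comparison_point_def\<close>)
  then have "cos (k * model_dist \<kappa> z' r') \<le> cos (k * dist z r)"
    using model_dist_bounds[OF \<kappa> zs'(1) car(3)] k
    unfolding k_def by (intro cos_monotone_0_pi_le) auto
  then have "z' \<bullet> r' \<le> cos (k * dist z r)"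
    using cos_model_dist[OF \<kappa> zs'(1) car(3)] by (simp add: k_def)
  moreover have "0 \<le> sin (k * dist x y)"
    using scaled_dist_bounds[of x y] unfolding k_def by (intro sin_ge_zero) auto
  ultimately have "sin (k * dist x y) * (z' \<bullet> r') \<le> sin (k * dist x y) * cos (k * dist z r)"
    by (intro mult_left_mono)
  moreover have "p \<bullet> r' = cos (k * dist x r)" "q \<bullet> r' = cos (k * dist y r)"
    using cos_model_dist[OF \<kappa> car(3,1)] cos_model_dist[OF \<kappa> car(2,3)] ds
    by (simp_all add: k_def inner_commute dist_commute)
  ultimately show ?thesis
    using model_sine_equality[OF \<kappa> car(1,2) segs(1) z'(1)] by (simp add: ds z' zq k_def)
qed

text \<open>
  If \<open>z'\<close> has the same distances to \<open>x\<close> and \<open>y\<close> as \<open>z\<close>, then \<open>sine_inequality\<close> with \<open>r = z'\<close> has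
  \<open>sin (k d(x, y))\<close> on the left, by the addition theorem, and this forces \<open>cos (k d(z, z')) = 1\<close>.
\<close>
lemma geodesic_point_unique:
  fixes x y z z' :: 'a
  assumes seg: "geodesic_segment UNIV dist x y S" "z \<in> S"
    and eq: "dist x z' = dist x z" "dist y z' = dist y z"
  shows "z' = z"
proof (cases "x = y")
  case True
  then have "dist x z = 0" using geodesic_segmentD[OF seg] by simp
  then show ?thesis using eq by simp
next
  case False
  let ?k = "sqrt \<kappa>"
  note zs = geodesic_segmentD[OF seg]
  have "sin (?k * dist x y) = sin (?k * dist z y + ?k * dist x z)" unfolding zs(4) by (simp add: algebra_simps)
  also have "\<dots> \<le> sin (?k * dist x y) * cos (?k * dist z z')"
    using sine_inequality[OF seg, of z'] eq by (simp add: sin_add dist_commute algebra_simps)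
  finally have "sin (?k * dist x y) * 1 \<le> sin (?k * dist x y) * cos (?k * dist z z')" by simp
  moreover have "0 < sin (?k * dist x y)"
    using scaled_dist_bounds(3)[of x y] \<kappa> False by (intro sin_gt_zero) auto
  ultimately have "1 \<le> cos (?k * dist z z')" by (metis mult_le_cancel_left_pos)
  then have "\<not> 0 < ?k * dist z z'"
    using cos_monotone_0_pi[of 0 "?k * dist z z'"] scaled_dist_bounds(3)[of z z'] by auto
  then show ?thesis using \<kappa> by (simp add: zero_less_mult_iff)
qed

lemma geodesic_point_on_segment:
  fixes x y :: 'a
  assumes t: "t \<in> {0..1}"
  obtains S where "geodesic_segment UNIV dist x y S" "geodesic_point t x y \<in> S"
    "dist x (geodesic_point t x y) = t * dist x y" "dist (geodesic_point t x y) y = (1 - t) * dist x y"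
proof -
  obtain S where S: "geodesic_segment UNIV dist x y S" using geodesic_exists by blast
  have "t * dist x y \<in> {0..dist x y}" using t by (auto simp: mult_left_le_one_le)
  then obtain z where z: "z \<in> S" "dist x z = t * dist x y" using geodesic_segment_point_at[OF S] by blast
  have "(\<exists>S. geodesic_segment UNIV dist x y S \<and> geodesic_point t x y \<in> S) \<and>
      dist (geodesic_point t x y) x = t * dist x y \<and> dist (geodesic_point t x y) y = (1 - t) * dist x y"
    unfolding geodesic_point_def
  proof (rule theI)
    show z1: "(\<exists>S. geodesic_segment UNIV dist x y S \<and> z \<in> S) \<and>
        dist z x = t * dist x y \<and> dist z y = (1 - t) * dist x y"
      using S z geodesic_segmentD(4)[OF S z(1)] by (auto simp: dist_commute algebra_simps)
    show "w = z" if w: "(\<exists>S. geodesic_segment UNIV dist x y S \<and> w \<in> S) \<and>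
        dist w x = t * dist x y \<and> dist w y = (1 - t) * dist x y" for w
      by (rule geodesic_point_unique[OF S z(1)]) (use w z1 in \<open>auto simp: dist_commute\<close>)
  qed
  then show ?thesis using that by (metis dist_commute)
qed

text \<open>
  This rescales \<open>spherical_comparison_sq_le\<close>: both sides are homogeneous of degree two in the
  distances.
\<close>
lemma geodesic_point_sq_dist_le:
  fixes x y r :: 'a
  assumes t: "t \<in> {0..1}"
  shows "(dist (geodesic_point t x y) r)\<^sup>2 \<le>
    (1 - t) * (dist x r)\<^sup>2 + t * (dist y r)\<^sup>2 - \<rho> * cot \<rho> * (t * (1 - t) * (dist x y)\<^sup>2)"
proof -
  let ?k = "sqrt \<kappa>" and ?z = "geodesic_point t x y"
  obtain S where S: "geodesic_segment UNIV dist x y S" "?z \<in> S"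
    and z: "dist x ?z = t * dist x y" "dist ?z y = (1 - t) * dist x y"
    using geodesic_point_on_segment[OF t] .
  show ?thesis
  proof (cases "x = y")
    case True
    then show ?thesis using z by (simp add: algebra_simps)
  next
    case False
    have k: "?k > 0" using \<kappa> by simp
    have "(?k * dist ?z r)\<^sup>2 \<le> (1 - t) * (?k * dist x r)\<^sup>2 + t * (?k * dist y r)\<^sup>2
        - \<rho> * cot \<rho> * (t * (1 - t) * (?k * dist x y)\<^sup>2)"
    proof (rule spherical_comparison_sq_le[OF \<rho> _ small _ small _ small _ _ t])
      show "0 < ?k * dist x y" using k False by simp
      show "0 \<le> ?k * dist x r" "0 \<le> ?k * dist y r" "0 \<le> ?k * dist ?z r" using k by auto
      show "?k * dist ?z r \<le> pi" using scaled_dist_bounds(3)[of ?z r] by linarith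
      have "\<bar>dist x r - dist x y\<bar> \<le> dist y r" by metric
      then have "?k * \<bar>dist x r - dist x y\<bar> \<le> ?k * dist y r" using k by (intro mult_left_mono) auto
      then show "\<bar>?k * dist x r - ?k * dist x y\<bar> \<le> ?k * dist y r"
        using k by (simp add: abs_mult right_diff_distrib[symmetric])
      have "dist y r \<le> dist x r + dist x y" by metric
      then show "?k * dist y r \<le> ?k * dist x r + ?k * dist x y"
        using k by (simp add: distrib_left[symmetric])
      show "sin ((1 - t) * (?k * dist x y)) * cos (?k * dist x r) + sin (t * (?k * dist x y)) * cos (?k * dist y r)
          \<le> sin (?k * dist x y) * cos (?k * dist ?z r)"
        using sine_inequality[OF S, of r] unfolding z by (simp add: mult.left_commute)
    qed
    then have "\<kappa> * (dist ?z r)\<^sup>2 \<le> \<kappa> * ((1 - t) * (dist x r)\<^sup>2 + t * (dist y r)\<^sup>2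
        - \<rho> * cot \<rho> * (t * (1 - t) * (dist x y)\<^sup>2))"
      using \<kappa> by (simp add: power_mult_distrib algebra_simps)
    then show ?thesis using \<kappa> by simp
  qed
qed

text \<open>
  The Pythagorean inequality at a nearest point \<open>q\<close>, where the angle is at least a right angle.
  Comparing \<open>d(z, q)\<close> with the distance from \<open>z\<close> to the point of \<open>[q, p]\<close> at distance \<open>s\<close> from
  \<open>q\<close> gives an inequality \<open>0 \<le> f s\<close> with equality at \<open>s = 0\<close>; the claim is \<open>0 \<le> f' 0\<close>.
\<close>
lemma nearest_point_cosine_le:
  fixes z p q :: 'a
  assumes K: "geodesically_convex K" "q \<in> K" "p \<in> K" and near: "\<And>w. w \<in> K \<Longrightarrow> dist z q \<le> dist z w"
  defines "k \<equiv> sqrt \<kappa>"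
  shows "cos (k * dist z p) \<le> cos (k * dist z q) * cos (k * dist q p)"
proof (cases "q = p")
  case True
  then show ?thesis by simp
next
  case False
  define l where "l = k * dist q p"
  define f where "f = (\<lambda>s. (sin l - sin (l - s)) * cos (k * dist z q) - sin s * cos (k * dist z p))"
  have k: "k > 0" using \<kappa> by (simp add: k_def)
  have l: "0 < l" "l < pi" using False k scaled_dist_bounds(3)[of q p] by (auto simp: l_def k_def)
  obtain S where S: "geodesic_segment UNIV dist q p S" using geodesic_exists by blast
  have f0: "0 \<le> f s" if s: "s \<in> {0..l}" for s
  proof -
    have "s / k \<in> {0..dist q p}" using s k by (auto simp: l_def field_simps)
    then obtain w where w: "w \<in> S" "dist q w = s / k" using geodesic_segment_point_at[OF S] by blast
    have wp: "k * dist w p = l - s" "k * dist q w = s"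
      using geodesic_segmentD(4)[OF S w(1)] w k by (auto simp: l_def field_simps)
    have "w \<in> K" using K S w unfolding geodesically_convex_def by blast
    then have "cos (k * dist z w) \<le> cos (k * dist z q)"
      using near k scaled_dist_bounds(3)[of z w] unfolding k_def by (intro cos_monotone_0_pi_le) auto
    then have "sin l * cos (k * dist z w) \<le> sin l * cos (k * dist z q)"
      using l by (intro mult_left_mono sin_ge_zero) auto
    moreover have "sin (l - s) * cos (k * dist z q) + sin s * cos (k * dist z p) \<le> sin l * cos (k * dist z w)"
      using sine_inequality[OF S w(1), of z] wp unfolding k_def[symmetric] l_def[symmetric]
      by (simp add: dist_commute)
    ultimately show ?thesis by (simp add: f_def algebra_simps)
  qed
  have D: "(f has_real_derivative cos (k * dist z q) * cos l - cos (k * dist z p)) (at 0)"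
    unfolding f_def by (auto intro!: derivative_eq_intros)
  have "0 \<le> cos (k * dist z q) * cos l - cos (k * dist z p)"
  proof (rule ccontr)
    assume "\<not> ?thesis"
    then obtain d where d: "d > 0" "\<And>h. 0 < h \<Longrightarrow> h < d \<Longrightarrow> f (0 + h) < f 0"
      using DERIV_neg_dec_right[OF D] by auto
    have "f (min (d / 2) l) < 0" using d(2)[of "min (d / 2) l"] d(1) l by (auto simp: f_def)
    then show False using f0[of "min (d / 2) l"] d l by auto
  qed
  then show ?thesis by (simp add: l_def)
qed

text \<open>
  For two nearest points \<open>p\<close> and \<open>q\<close>, \<open>nearest_point_cosine_le\<close> can be divided by the common
  positive value \<open>cos (k d(z, p)) = cos (k d(z, q))\<close>, which leaves \<open>1 \<le> cos (k d(q, p))\<close>.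
\<close>
lemma metric_proj_nearest:
  fixes z :: 'a
  assumes K: "compact K" "K \<noteq> {}" "geodesically_convex K"
  shows "metric_proj K z \<in> K \<and> (\<forall>w\<in>K. dist z (metric_proj K z) \<le> dist z w)"
proof -
  let ?k = "sqrt \<kappa>"
  have "continuous_on K (dist z)" by (intro continuous_intros)
  then obtain q where q: "q \<in> K" "\<And>w. w \<in> K \<Longrightarrow> dist z q \<le> dist z w"
    using continuous_attains_inf[OF K(1,2)] by metis
  show ?thesis unfolding metric_proj_def
  proof (rule theI)
    show "q \<in> K \<and> (\<forall>w\<in>K. dist z q \<le> dist z w)" using q by blast
    fix p assume p: "p \<in> K \<and> (\<forall>w\<in>K. dist z p \<le> dist z w)"
    then have "dist z p = dist z q" using q by (meson antisym)
    then have "cos (?k * dist z q) * 1 \<le> cos (?k * dist z q) * cos (?k * dist q p)"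
      using nearest_point_cosine_le[OF K(3) q(1) _ q(2), of p] p by simp
    moreover have "0 < cos (?k * dist z q)"
      using scaled_dist_bounds(1,2)[of z q] pi_gt_zero by (intro cos_gt_zero_pi) linarith+
    ultimately have "1 \<le> cos (?k * dist q p)" by (metis mult_le_cancel_left_pos)
    then have "\<not> 0 < ?k * dist q p"
      using cos_monotone_0_pi[of 0 "?k * dist q p"] scaled_dist_bounds(3)[of q p] by auto
    then show "p = q" using \<kappa> by (simp add: zero_less_mult_iff)
  qed
qed

text \<open>
  Dropping the factor \<open>cos (k d(z, q)) \<le> 1\<close> in \<open>nearest_point_cosine_le\<close> is harmless because the
  other factor is nonnegative: distances, scaled by \<open>k = sqrt \<kappa>\<close>, are below \<open>pi / 2\<close>.
\<close>
lemma metric_proj_dist_le: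
  fixes z p :: 'a
  assumes K: "compact K" "geodesically_convex K" "p \<in> K"
  shows "dist (metric_proj K z) p \<le> dist z p"
proof -
  let ?k = "sqrt \<kappa>" and ?q = "metric_proj K z"
  have q: "?q \<in> K" "\<And>w. w \<in> K \<Longrightarrow> dist z ?q \<le> dist z w"
    using metric_proj_nearest[OF K(1) _ K(2)] K(3) by auto
  have "cos (?k * dist z p) \<le> cos (?k * dist z ?q) * cos (?k * dist ?q p)"
    by (rule nearest_point_cosine_le[OF K(2) q(1) K(3) q(2)])
  also have "\<dots> \<le> 1 * cos (?k * dist ?q p)"
    using scaled_dist_bounds(1,2)[of ?q p] pi_gt_zero
    by (intro mult_right_mono cos_ge_zero cos_le_one) linarith+
  finally have le: "cos (?k * dist z p) \<le> cos (?k * dist ?q p)" by simp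
  have "?k * dist ?q p \<le> ?k * dist z p"
  proof (rule ccontr)
    assume "\<not> ?thesis"
    then have "cos (?k * dist ?q p) < cos (?k * dist z p)"
      using scaled_dist_bounds(1,3)[of ?q p] \<kappa> by (intro cos_monotone_0_pi) auto
    then show False using le by simp
  qed
  then show ?thesis using \<kappa> by simp
qed

end

section \<open>Hybrid mappings at a strict fixed point\<close>

lemma dist_le_hausdorff_dist_singleton:
  fixes p v :: "'a::metric_space"
  assumes "bounded B" "v \<in> B"
  shows "dist v p \<le> hausdorff_dist {p} B" "infdist p B \<le> hausdorff_dist {p} B"
proof -
  obtain e where "\<forall>w\<in>B. dist p w \<le> e" using assms(1) bounded_any_center[of B p] by blast
  then have "bdd_above ((\<lambda>w. infdist w {p}) ` B)" by (intro bdd_aboveI[of _ e]) (auto simp: dist_commute)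
  then have "infdist v {p} \<le> (SUP w\<in>B. infdist w {p})" using assms(2) by (intro cSUP_upper) auto
  then show "dist v p \<le> hausdorff_dist {p} B" by (simp add: hausdorff_dist_def)
  show "infdist p B \<le> hausdorff_dist {p} B" by (simp add: hausdorff_dist_def)
qed

text \<open>
  In the hybrid inequality for \<open>p\<close> and \<open>z\<close> the \<open>k1\<close>-term vanishes, \<open>d(Tp, z)\<close> is \<open>d(p, z)\<close>, and
  \<open>d(p, Tz)\<close> is at most \<open>H(Tp, Tz)\<close>, so the \<open>a3\<close>-term moves to the left-hand side.
\<close>
lemma gen_hybrid_II_strict_fixed_point_le:
  fixes p z v :: "'a::metric_space"
  assumes T: "gen_hybrid_II K T a1 a2 a3 k1 k2" and p: "p \<in> K" "T p = {p}"
    and z: "z \<in> K" "T z \<in> KC" "v \<in> T z"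
  shows "(1 - a3 p) * (dist v p)\<^sup>2 \<le> (a1 p + a2 p) * (dist z p)\<^sup>2 + k2 p * (dist z v)\<^sup>2"
proof -
  let ?H = "hausdorff_dist {p} (T z)"
  have co: "0 \<le> a1 p" "0 \<le> a2 p" "0 \<le> a3 p" "a3 p \<le> 1" "0 \<le> k2 p" using T p(1) by (auto simp: gen_hybrid_II_def)
  have "bounded (T z)" using z(2) by (auto simp: KC_def compact_imp_bounded)
  note H = dist_le_hausdorff_dist_singleton[OF this z(3), of p]
  have "?H\<^sup>2 \<le> a1 p * (dist p z)\<^sup>2 + a2 p * (infdist z {p})\<^sup>2 + a3 p * (infdist p (T z))\<^sup>2
      + k1 p * (infdist p {p})\<^sup>2 + k2 p * (infdist z (T z))\<^sup>2"
    using T p z(1) unfolding gen_hybrid_II_def by metis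
  also have "\<dots> \<le> a1 p * (dist z p)\<^sup>2 + a2 p * (dist z p)\<^sup>2 + a3 p * ?H\<^sup>2 + 0 + k2 p * (dist z v)\<^sup>2"
    using H(2) infdist_le[OF z(3), of z] co
    by (intro add_mono mult_left_mono power_mono) (auto simp: dist_commute infdist_nonneg)
  finally have "(1 - a3 p) * ?H\<^sup>2 \<le> (a1 p + a2 p) * (dist z p)\<^sup>2 + k2 p * (dist z v)\<^sup>2"
    by (simp add: algebra_simps)
  moreover have "(1 - a3 p) * (dist v p)\<^sup>2 \<le> (1 - a3 p) * ?H\<^sup>2"
    using H(1) co by (intro mult_left_mono power_mono) auto
  ultimately show ?thesis by linarith
qed

text \<open>
  The asymptotic radius of a convergent sequence at \<open>r\<close> is the distance from \<open>r\<close> to the limit, and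
  subsequences have the same limit.
\<close>
lemma tendsto_imp_delta_converges:
  fixes x :: "nat \<Rightarrow> 'a::metric_space"
  assumes "x \<longlonglongrightarrow> p"
  shows "delta_converges x p"
  unfolding delta_converges_def
proof (intro conjI allI impI)
  show "bounded (range x)" using assms convergentI convergent_imp_bounded by blast
  fix \<sigma> :: "nat \<Rightarrow> nat" assume "strict_mono \<sigma>"
  then have "(x \<circ> \<sigma>) \<longlonglongrightarrow> p" using assms by (rule LIMSEQ_subseq_LIMSEQ[rotated])
  then have "(\<lambda>n. ereal (dist r ((x \<circ> \<sigma>) n))) \<longlonglongrightarrow> ereal (dist r p)" for r
    by (intro tendsto_intros)
  then have rad: "asymp_radius_at r (x \<circ> \<sigma>) = ereal (dist r p)" for r
    unfolding asymp_radius_at_def by (intro lim_imp_Limsup) auto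
  have "asymp_radius (x \<circ> \<sigma>) = 0"
    unfolding asymp_radius_def rad
  proof (rule antisym)
    show "(INF r. ereal (dist r p)) \<le> 0" by (rule INF_lower2[of p]) auto
  qed (auto intro: INF_greatest)
  then show "asymp_center (x \<circ> \<sigma>) = {p}" by (auto simp: asymp_center_def rad)
qed

section \<open>Convergence of the iteration\<close>

text \<open>
  For fixed \<open>n\<close>, \<open>X\<close>, \<open>V\<close>, \<open>Y\<close>, \<open>Z\<close> are the squared distances \<open>d(z, p)\<^sup>2\<close>, \<open>d(w, p)\<^sup>2\<close>,
  \<open>d(z, w)\<^sup>2\<close> and \<open>d((1 - \<beta>) z \<oplus> \<beta> w, p)\<^sup>2\<close>. The statement is uniform in them because it is used
  for \<open>x n\<close> with \<open>\<beta>\<close> and for \<open>y n\<close> with \<open>\<alpha>\<close>.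
\<close>
lemma weighted_step_contraction:
  fixes R c \<theta> \<mu> :: real and \<beta> :: "nat \<Rightarrow> real"
  assumes R: "0 < R" "R / 4 \<le> \<mu>" and c: "0 \<le> c" and \<theta>: "\<theta> < 1"
    and \<beta>: "\<And>n. \<beta> n \<in> {0..1}"
    and lim: "liminf (\<lambda>n. ereal (\<beta> n * ((1 - \<beta> n) * (R / 2) - 2 * c))) > 0"
  shows "\<exists>q<1. \<forall>\<^sub>F n in sequentially. \<forall>X V Y Z. 0 \<le> X \<longrightarrow> 0 \<le> Y \<longrightarrow> V \<le> \<theta> * X + c * Y \<longrightarrow>
    Z \<le> (1 - \<beta> n) * X + \<beta> n * V - \<mu> * (\<beta> n * (1 - \<beta> n) * Y) \<longrightarrow> Z \<le> q * X"
proof -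
  obtain e where e: "0 < e" "ereal e < liminf (\<lambda>n. ereal (\<beta> n * ((1 - \<beta> n) * (R / 2) - 2 * c)))"
    using ereal_dense2[OF lim] by auto
  (* The expression under the lower limit is at most beta R / 2, so once it exceeds e, beta exceeds b. *)
  define b where "b = 2 * e / R"
  have b: "0 < b" using e R by (simp add: b_def)
  have "\<forall>\<^sub>F n in sequentially. ereal e < ereal (\<beta> n * ((1 - \<beta> n) * (R / 2) - 2 * c))"
    by (rule less_LiminfD[OF e(2)])
  then have "\<forall>\<^sub>F n in sequentially. \<forall>X V Y Z. 0 \<le> X \<longrightarrow> 0 \<le> Y \<longrightarrow> V \<le> \<theta> * X + c * Y \<longrightarrow>
    Z \<le> (1 - \<beta> n) * X + \<beta> n * V - \<mu> * (\<beta> n * (1 - \<beta> n) * Y) \<longrightarrow> Z \<le> (1 - b * (1 - \<theta>)) * X"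
  proof (eventually_elim, intro allI impI)
    fix n and X V Y Z :: real
    assume pos: "ereal e < ereal (\<beta> n * ((1 - \<beta> n) * (R / 2) - 2 * c))"
      and X: "0 \<le> X" and Y: "0 \<le> Y" and V: "V \<le> \<theta> * X + c * Y"
      and Z: "Z \<le> (1 - \<beta> n) * X + \<beta> n * V - \<mu> * (\<beta> n * (1 - \<beta> n) * Y)"
    have bn: "0 \<le> \<beta> n" "\<beta> n \<le> 1" using \<beta>[of n] by auto
    have "0 < \<beta> n * ((1 - \<beta> n) * (R / 2) - 2 * c)" using pos e by simp
    then have "0 < (1 - \<beta> n) * (R / 2) - 2 * c" using bn by (simp add: zero_less_mult_iff)
    then have "c \<le> (1 - \<beta> n) * (R / 4)" by (simp add: field_simps)
    moreover have "(1 - \<beta> n) * (R / 4) \<le> (1 - \<beta> n) * \<mu>" using bn R by (intro mult_left_mono) auto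
    ultimately have "c \<le> (1 - \<beta> n) * \<mu>" by (rule order_trans)
    then have "\<beta> n * (c * Y) \<le> \<beta> n * ((1 - \<beta> n) * \<mu> * Y)"
      using bn Y by (intro mult_left_mono mult_right_mono)
    moreover have "\<beta> n * V \<le> \<beta> n * (\<theta> * X + c * Y)" using V bn by (intro mult_left_mono)
    ultimately have "Z \<le> (1 - \<beta> n * (1 - \<theta>)) * X" using Z by (simp add: algebra_simps)
    also have "\<dots> \<le> (1 - b * (1 - \<theta>)) * X"
    proof -
      have "\<beta> n * ((1 - \<beta> n) * (R / 2) - 2 * c) \<le> \<beta> n * (1 * (R / 2) - 0)"
        using bn R c by (intro mult_left_mono diff_mono mult_right_mono) auto
      then have "b \<le> \<beta> n" using pos R by (simp add: b_def field_simps)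
      then have "b * (1 - \<theta>) \<le> \<beta> n * (1 - \<theta>)" using \<theta> by (intro mult_right_mono) auto
      then show ?thesis using X by (intro mult_right_mono) auto
    qed
    finally show "Z \<le> (1 - b * (1 - \<theta>)) * X" .
  qed
  moreover have "1 - b * (1 - \<theta>) < 1" using b \<theta> by simp
  ultimately show ?thesis by blast
qed

theorem theorem4p20:
  fixes \<kappa> \<epsilon> R :: real
    and K :: "'a::complete_space set"
    and T :: "'a \<Rightarrow> 'a set"
    and a1 a2 a3 k1 k2 :: "'a \<Rightarrow> real"
    and \<alpha> \<beta> :: "nat \<Rightarrow> real"
    and x y u v :: "nat \<Rightarrow> 'a"
  assumes "\<kappa> > 0"
    and "CAT_space \<kappa> (UNIV :: 'a set) dist"
    and "\<epsilon> \<in> {0<..<pi / 2}"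
    and "bounded (UNIV :: 'a set)"
    and "diameter (UNIV :: 'a set) \<le> (pi - \<epsilon>) / (2 * sqrt \<kappa>)"
    and "R = (pi - 2 * \<epsilon>) * tan \<epsilon>"
    and "K \<noteq> {}" and "compact K" and "geodesically_convex K"
    and "\<forall>p\<in>K. T p \<in> KC"
    and "gen_hybrid_II K T a1 a2 a3 k1 k2"
    and "\<forall>p\<in>K. 2 * k1 p / (1 - a2 p) < R / 2"
    and "fixed_points K T \<noteq> {}"
    and "\<forall>p\<in>fixed_points K T. T p = {p}"
    and "\<forall>n. \<alpha> n \<in> {0..1}" and "\<forall>n. \<beta> n \<in> {0..1}"
    and "\<forall>n. x n \<in> K"
    and "\<forall>n. v n \<in> T (x n)"
    and "\<forall>n. y n = metric_proj K (geodesic_point (\<beta> n) (x n) (v n))"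
    and "\<forall>n. u n \<in> T (y n)"
    and "\<forall>n. x (Suc n) = metric_proj K (geodesic_point (\<alpha> n) (y n) (u n))"
    and "\<forall>p\<in>K. liminf (\<lambda>n. ereal (\<alpha> n * ((1 - \<alpha> n) * (R / 2) - 2 * k2 p / (1 - a3 p)))) > 0"
    and "\<forall>p\<in>K. liminf (\<lambda>n. ereal (\<beta> n * ((1 - \<beta> n) * (R / 2) - 2 * k2 p / (1 - a3 p)))) > 0"
  shows "\<exists>q\<in>fixed_points K T. delta_converges x q"
proof -
  note \<kappa> = assms(1) and cat = assms(2) and \<epsilon> = assms(3) and K = assms(8,7,9) and KC = assms(10)
    and hyb = assms(11) and xK = assms(17)
  obtain p where p: "p \<in> fixed_points K T" using assms(13) by blast
  then have Tp: "T p = {p}" using assms(14) by blast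
  have pK: "p \<in> K" using p by (simp add: fixed_points_def)
  define \<rho> where "\<rho> = (pi - \<epsilon>) / 2"
  have \<rho>: "\<rho> < pi / 2" using \<epsilon> by (simp add: \<rho>_def)
  have small: "sqrt \<kappa> * dist w z \<le> \<rho>" for w z :: 'a
  proof -
    have "dist w z \<le> (pi - \<epsilon>) / (2 * sqrt \<kappa>)"
      using diameter_bounded_bound[OF assms(4), of w z] assms(5) by simp
    then show ?thesis using \<kappa> by (simp add: \<rho>_def field_simps)
  qed
  have R: "0 < R" "R / 4 \<le> \<rho> * cot \<rho>"
    using \<epsilon> convexity_constant_bound[of \<epsilon>] by (auto simp: assms(6) \<rho>_def intro!: mult_pos_pos tan_gt_zero)
  define \<theta> c where "\<theta> = (a1 p + a2 p) / (1 - a3 p)" and "c = k2 p / (1 - a3 p)"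
  have co: "a1 p \<ge> 0" "a2 p \<ge> 0" "k2 p \<ge> 0" "a1 p + a2 p + a3 p < 1"
    using hyb pK by (auto simp: gen_hybrid_II_def)
  then have a3: "0 < 1 - a3 p" by simp
  then have \<theta>: "\<theta> < 1" and c: "0 \<le> c" using co by (auto simp: \<theta>_def c_def)
  have step: "\<exists>q<1. \<forall>\<^sub>F n in sequentially. \<forall>z\<in>K. \<forall>w\<in>T z.
      (dist (metric_proj K (geodesic_point (\<gamma> n) z w)) p)\<^sup>2 \<le> q * (dist z p)\<^sup>2"
    if \<gamma>: "\<And>n. \<gamma> n \<in> {0..1}"
      and lim: "liminf (\<lambda>n. ereal (\<gamma> n * ((1 - \<gamma> n) * (R / 2) - 2 * k2 p / (1 - a3 p)))) > 0" for \<gamma>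
  proof -
    have "liminf (\<lambda>n. ereal (\<gamma> n * ((1 - \<gamma> n) * (R / 2) - 2 * c))) > 0"
      using lim by (simp add: c_def)
    from weighted_step_contraction[OF R c \<theta> \<gamma> this]
    obtain q where q: "q < 1" and ev: "\<forall>\<^sub>F n in sequentially. \<forall>X V Y Z. 0 \<le> X \<longrightarrow> 0 \<le> Y \<longrightarrow>
        V \<le> \<theta> * X + c * Y \<longrightarrow>
        Z \<le> (1 - \<gamma> n) * X + \<gamma> n * V - \<rho> * cot \<rho> * (\<gamma> n * (1 - \<gamma> n) * Y) \<longrightarrow> Z \<le> q * X" by blast
    from ev have "\<forall>\<^sub>F n in sequentially. \<forall>z\<in>K. \<forall>w\<in>T z.
      (dist (metric_proj K (geodesic_point (\<gamma> n) z w)) p)\<^sup>2 \<le> q * (dist z p)\<^sup>2"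
    proof (eventually_elim, intro ballI)
      fix n z w
      assume elim: "\<forall>X V Y Z. 0 \<le> X \<longrightarrow> 0 \<le> Y \<longrightarrow> V \<le> \<theta> * X + c * Y \<longrightarrow>
          Z \<le> (1 - \<gamma> n) * X + \<gamma> n * V - \<rho> * cot \<rho> * (\<gamma> n * (1 - \<gamma> n) * Y) \<longrightarrow> Z \<le> q * X"
        "z \<in> K" "w \<in> T z"
      let ?g = "geodesic_point (\<gamma> n) z w"
      have "(1 - a3 p) * (dist w p)\<^sup>2 \<le> (a1 p + a2 p) * (dist z p)\<^sup>2 + k2 p * (dist z w)\<^sup>2"
        using gen_hybrid_II_strict_fixed_point_le[OF hyb pK Tp] elim(2,3) KC by blast
      then have "(dist w p)\<^sup>2 \<le> ((a1 p + a2 p) * (dist z p)\<^sup>2 + k2 p * (dist z w)\<^sup>2) / (1 - a3 p)"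
        using a3 by (simp add: pos_le_divide_eq mult.commute)
      then have "(dist w p)\<^sup>2 \<le> \<theta> * (dist z p)\<^sup>2 + c * (dist z w)\<^sup>2"
        by (simp add: \<theta>_def c_def add_divide_distrib distrib_right)
      then have "(dist ?g p)\<^sup>2 \<le> q * (dist z p)\<^sup>2"
        by (rule elim(1)[rule_format, OF zero_le_power2 zero_le_power2 _
            geodesic_point_sq_dist_le[OF \<kappa> \<rho> cat small \<gamma>]])
      moreover have "(dist (metric_proj K ?g) p)\<^sup>2 \<le> (dist ?g p)\<^sup>2"
        using metric_proj_dist_le[OF \<kappa> \<rho> cat small K(1,3) pK] by (intro power_mono) auto
      ultimately show "(dist (metric_proj K ?g) p)\<^sup>2 \<le> q * (dist z p)\<^sup>2" by linarith
    qed
    then show ?thesis using q by blast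
  qed
  have yK: "y n \<in> K" for n
    using metric_proj_nearest[OF \<kappa> \<rho> cat small K] assms(19) by metis
  obtain q where q: "q < 1" "\<forall>\<^sub>F n in sequentially. \<forall>z\<in>K. \<forall>w\<in>T z.
      (dist (metric_proj K (geodesic_point (\<beta> n) z w)) p)\<^sup>2 \<le> q * (dist z p)\<^sup>2"
    using step[of \<beta>] assms(16,23) pK by blast
  obtain q' where q': "q' < 1" "\<forall>\<^sub>F n in sequentially. \<forall>z\<in>K. \<forall>w\<in>T z.
      (dist (metric_proj K (geodesic_point (\<alpha> n) z w)) p)\<^sup>2 \<le> q' * (dist z p)\<^sup>2"
    using step[of \<alpha>] assms(15,22) pK by blast
  have "\<forall>\<^sub>F n in sequentially. (dist (x (Suc n)) p)\<^sup>2 \<le> q * (dist (x n) p)\<^sup>2"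
    using q(2) q'(2)
  proof eventually_elim
    case (elim n)
    (* One contracting half-step suffices; the other one need only not increase the distance. *)
    have "(dist (x (Suc n)) p)\<^sup>2 \<le> q' * (dist (y n) p)\<^sup>2" using elim(2) yK assms(20,21) by simp
    also have "\<dots> \<le> 1 * (dist (y n) p)\<^sup>2" using q'(1) by (intro mult_right_mono) auto
    also have "\<dots> \<le> q * (dist (x n) p)\<^sup>2" using elim(1) xK assms(18,19) by simp
    finally show ?case .
  qed
  then obtain N where N: "\<And>n. n \<ge> N \<Longrightarrow> (dist (x (Suc n)) p)\<^sup>2 \<le> q * (dist (x n) p)\<^sup>2"
    by (auto simp: eventually_sequentially)
  have "summable (\<lambda>n. (dist (x n) p)\<^sup>2)"
    by (rule summable_ratio_test[OF q(1)]) (use N in auto)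
  then have "(\<lambda>n. sqrt ((dist (x n) p)\<^sup>2)) \<longlonglongrightarrow> sqrt 0"
    by (intro tendsto_real_sqrt summable_LIMSEQ_zero)
  then have "(\<lambda>n. dist (x n) p) \<longlonglongrightarrow> 0" by simp
  then have "x \<longlonglongrightarrow> p" by (rule iffD2[OF tendsto_dist_iff])
  then show ?thesis using p tendsto_imp_delta_converges by blast
qed

end
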